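(* Let $\lambda_1$ and $\lambda_2$ be two distinct points in $\mathbb{D}$, and let $\omega_1$ and $\omega_2$ be points in $\mathbb{D}$. Then the following conditions are equivalent. (i) The $2\times 2$ matrix $M_\Phi(\lambda_1,\lambda_2;\omega_1,\omega_2)$ is positive semi-definite. (ii) The Pick matrix $P(\lambda_1,\lambda_2;\omega_1,\omega_2)=\left(\dfrac{1-\omega_i\overline{\omega_j}}{1-\lambda_i\overline{\lambda_j}}\right)_{1\le i,j\le 2}$ is positive semi-definite. (iii) $\rho(\omega_1,\omega_2)\le\rho(\lambda_1,\lambda_2)$. (iv) There exists a map $F$ in $\mathcal{RS}_\Phi(\Omega)$ such that $F(\Phi(\lambda_j))=\Phi(\omega_j)$ for $j=1,2$.
   Context: $\mathbb{D}$ is the open unit disk in $\mathbb{C}$. $k(z,\lambda)=\frac{1}{(1-\overline{\lambda}z)^2}$ is the Bergman kernel on $\mathbb{D}$, and $\rho(\lambda,\mu)=\sqrt{1-\frac{|k(\lambda,\mu)|^2}{k(\lambda,\lambda)k(\mu,\mu)}}$ for $\lambda,\mu\in\mathbb{D}$. $\mathcal{K}=(\mathbb{C}^2,\langle\cdot,\cdot\rangle_{\mathcal{K}})$ is the indefinite inner product space with $\langle(\lambda_1,\lambda_2)^\top,(\mu_1,\mu_2)^\top\rangle_{\mathcal{K}}=\lambda_1\overline{\mu_1}-\lambda_2\overline{\mu_2}$. The map $\Phi:\mathbb{D}\to\mathbb{C}^2$ is $\Phi(\lambda)=(\sqrt{2}\lambda,\lambda^2)^\top$. For points $\lambda_1,\lambda_2,\mu_1,\mu_2\in\mathbb{D}$,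 $$M_\Phi(\lambda_1,\lambda_2;\mu_1,\mu_2)=\left(\frac{1-\langle\Phi(\mu_i),\Phi(\mu_j)\rangle_{\mathcal{K}}}{1-\langle\Phi(\lambda_i),\Phi(\lambda_j)\rangle_{\mathcal{K}}}\right)_{1\le i,j\le 2}.$$ $\Omega=\{\boldsymbol{z}\in\mathcal{K}:\langle\boldsymbol{z},\boldsymbol{z}\rangle_{\mathcal{K}}<1\}=\{(z_1,z_2)^\top\in\mathbb{C}^2:|z_1|^2-|z_2|^2<1\}$. $\mathcal{R}(\Omega)$ is the set of all rational self-maps of $\Omega$: maps $F=(f_1,f_2)^\top$ whose components $f_1,f_2$ are quotients of polynomials in $(z_1,z_2)$ (with denominators not identically zero), such that $F(\boldsymbol{z})\in\Omega$ for every $\boldsymbol{z}\in\Omega$ at which $F$ is defined, i.e. at which the denominators do not vanish. Such an $F$ need not be defined everywhere on $\Omega$. $\mathcal{RS}_\Phi(\Omega)$ is the set of all $F\in\mathcal{R}(\Omega)$ such that the kernel $$(z,\lambda)\mapsto\frac{1-\langle F(\Phi(z)),F(\Phi(\lambda))\rangle_{\mathcal{K}}}{1-\langle\Phi(z),\Phi(\lambda)\rangle_{\mathcal{K}}}$$ is positive semi-definite on $\mathbb{D}$, where $z,\lambda$ range over the points of $\mathbb{D}$ at which $F\circ\Phi$ is defined. In (iv), the condition $F(\Phi(\lambda_j))=\Phi(\omega_j)$ includes that $F$ is defined at $\Phi(\lambda_j)$. A kernel $L$ is positive semi-definite if every matrix $(L(z_i,z_j))_{1\le i,j\le n}$ formed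 from finitely many points is positive semi-definite. *)

theory Defs
  imports
    "HOL-Analysis.Analysis"
    "HOL-Computational_Algebra.Computational_Algebra"
begin

abbreviation unit_disk :: "complex set"
  where "unit_disk \<equiv> ball 0 1"

definition bergman_kernel :: "complex \<Rightarrow> complex \<Rightarrow> complex"
  where "bergman_kernel z l = 1 / (1 - cnj l * z)\<^sup>2"

text \<open>On the diagonal the Bergman kernel is real (and positive), so \<open>Re\<close> below only
  adjusts the type.\<close>

definition bergman_dist :: "complex \<Rightarrow> complex \<Rightarrow> real"
  where "bergman_dist l m =
    sqrt (1 - (cmod (bergman_kernel l m))\<^sup>2 /
              (Re (bergman_kernel l l) * Re (bergman_kernel m m)))"

definition inner_K :: "complex \<times> complex \<Rightarrow> complex \<times> complex \<Rightarrow> complex"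
  where "inner_K x y = fst x * cnj (fst y) - snd x * cnj (snd y)"

definition Phi :: "complex \<Rightarrow> complex \<times> complex"
  where "Phi l = (complex_of_real (sqrt 2) * l, l\<^sup>2)"

text \<open>The value \<open>inner_K z z\<close> is always real.\<close>

definition Omega :: "(complex \<times> complex) set"
  where "Omega = {z. Re (inner_K z z) < 1}"

text \<open>An \<open>n \<times> n\<close> matrix is a function of two indices \<open>i, j < n\<close>. Over the complex numbers,
  reality of the quadratic form for all vectors already forces the matrix to be Hermitian.\<close>

definition psd_matrix :: "nat \<Rightarrow> (nat \<Rightarrow> nat \<Rightarrow> complex) \<Rightarrow> bool"
  where "psd_matrix n A \<longleftrightarrow>
    (\<forall>c :: nat \<Rightarrow> complex.
       let s = (\<Sum>i<n. \<Sum>j<n. A i j * c j * cnj (c i)) in s \<in> \<real> \<and> 0 \<le> Re s)"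

definition psd_kernel_on :: "'a set \<Rightarrow> ('a \<Rightarrow> 'a \<Rightarrow> complex) \<Rightarrow> bool"
  where "psd_kernel_on S L \<longleftrightarrow>
    (\<forall>xs. set xs \<subseteq> S \<longrightarrow> psd_matrix (length xs) (\<lambda>i j. L (xs ! i) (xs ! j)))"

definition M_Phi :: "complex list \<Rightarrow> complex list \<Rightarrow> nat \<Rightarrow> nat \<Rightarrow> complex"
  where "M_Phi ls ms i j =
    (1 - inner_K (Phi (ms ! i)) (Phi (ms ! j))) / (1 - inner_K (Phi (ls ! i)) (Phi (ls ! j)))"

definition pick_matrix :: "complex list \<Rightarrow> complex list \<Rightarrow> nat \<Rightarrow> nat \<Rightarrow> complex"
  where "pick_matrix ls ms i j =
    (1 - ms ! i * cnj (ms ! j)) / (1 - ls ! i * cnj (ls ! j))"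

text \<open>A polynomial in \<open>(z\<^sub>1, z\<^sub>2)\<close> is a polynomial in \<open>z\<^sub>2\<close> whose coefficients are polynomials
  in \<open>z\<^sub>1\<close>.\<close>

definition poly2 :: "complex poly poly \<Rightarrow> complex \<times> complex \<Rightarrow> complex"
  where "poly2 p z = poly (poly p [:snd z:]) (fst z)"

text \<open>Rational maps are partial functions, undefined where a denominator vanishes. The
  quotients are taken in lowest terms. This excludes no rational function; it makes the
  domain independent of the representation, namely as large as possible.\<close>

definition rational_map ::
    "complex poly poly \<Rightarrow> complex poly poly \<Rightarrow> complex poly poly \<Rightarrow> complex poly poly
      \<Rightarrow> complex \<times> complex \<rightharpoonup> complex \<times> complex"
  where "rational_map p1 q1 p2 q2 z =
    (if poly2 q1 z \<noteq> 0 \<and> poly2 q2 z \<noteq> 0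
     then Some (poly2 p1 z / poly2 q1 z, poly2 p2 z / poly2 q2 z) else None)"

definition rational_maps :: "(complex \<times> complex \<rightharpoonup> complex \<times> complex) set"
  where "rational_maps =
    {rational_map p1 q1 p2 q2 | p1 q1 p2 q2.
       q1 \<noteq> 0 \<and> q2 \<noteq> 0 \<and> coprime p1 q1 \<and> coprime p2 q2}"

definition R_Omega :: "(complex \<times> complex \<rightharpoonup> complex \<times> complex) set"
  where "R_Omega = {F \<in> rational_maps. \<forall>z \<in> Omega \<inter> dom F. the (F z) \<in> Omega}"

definition RS_Phi_Omega :: "(complex \<times> complex \<rightharpoonup> complex \<times> complex) set"
  where "RS_Phi_Omega =
    {F \<in> R_Omega.
       psd_kernel_on {z \<in> unit_disk. Phi z \<in> dom F}
         (\<lambda>z l. (1 - inner_K (the (F (Phi z))) (the (F (Phi l)))) / (1 - inner_K (Phi z) (Phi l)))}"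

end

theory Submission
  imports Defs
begin

text \<open>
  Since \<open>1 - \<langle>\<Phi> z, \<Phi> \<lambda>\<rangle> = (1 - z \<lambda>\<^sup>*)\<^sup>2\<close>, conditions (i)--(iii) are determinant inequalities
  differing only by the exponent. In homogeneous coordinates \<open>\<Omega>\<close> consists of the positive vectors of the form
  \<open>h v v = |v\<^sub>1|\<^sup>2 - |v\<^sub>2|\<^sup>2 + |v\<^sub>3|\<^sup>2\<close> on \<open>\<complex>\<^sup>3\<close>, the symmetric square of the form of signature (1,1)
  that defines the disk. An invertible matrix \<open>A\<close> with \<open>h (A v) (A v) \<ge> s h v v\<close> for some \<open>s > 0\<close> therefore acts as
  a fractional linear self-map \<open>F\<close> of \<open>\<Omega>\<close>, and up to a rank one factor the kernel of \<open>F\<close> is \<open>s\<close>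
  plus the Schur product of the positive kernel \<open>h (A v) (A w) - s h v w\<close> with the Bergman kernel.
  To interpolate, move both pairs of points to symmetric positions \<open>\<plusminus>m\<close> and \<open>\<plusminus>n\<close> by symmetric squares of
  Moebius transformations; condition (iii) becomes \<open>|n| \<le> |m|\<close>, and there the matrix can be written down.
\<close>

unbundle no Formal_Power_Series.fps_syntax

section \<open>Positive semi-definite kernels\<close>

lemma psd_matrix_iff_nonneg_Reals:
  "psd_matrix n A \<longleftrightarrow> (\<forall>c. (\<Sum>i<n. \<Sum>j<n. A i j * c j * cnj (c i)) \<in> \<real>\<^sub>\<ge>\<^sub>0)"
  by (auto simp: psd_matrix_def Let_def complex_nonneg_Reals_iff complex_is_Real_iff)

text \<open>Completing the square: \<open>a\<close> times the quadratic form is \<open>|a c\<^sub>0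
  + b c\<^sub>1|\<^sup>2 + (a d - |b|\<^sup>2) |c\<^sub>1|\<^sup>2\<close>, so only the sign of the
  determinant matters.\<close>

lemma psd_matrix_2_iff:
  assumes "A 0 0 = complex_of_real a" "A 1 1 = complex_of_real d" "A 1 0 = cnj (A 0 1)" "a > 0"
  shows "psd_matrix 2 A \<longleftrightarrow> (cmod (A 0 1))\<^sup>2 \<le> a * d"
proof -
  define b where "b = A 0 1"
  define s where "s c = (\<Sum>i<2. \<Sum>j<2. A i j * c j * cnj (c i))" for c :: "nat \<Rightarrow> complex"
  have s: "a * s c = complex_of_real ((cmod (a * c 0 + b * c 1))\<^sup>2 + (a * d - (cmod b)\<^sup>2) * (cmod (c 1))\<^sup>2)" for c :: "nat \<Rightarrow> complex"
  proof -
    have "s c = a * c 0 * cnj (c 0) + b * c 1 * cnj (c 0) + cnj b * c 0 * cnj (c 1) + d * c 1 * cnj (c 1)"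
      using assms(1-3) by (simp add: s_def b_def numeral_2_eq_2 lessThan_Suc)
    then show ?thesis
      by (simp add: complex_norm_square algebra_simps del: of_real_power)
  qed
  show ?thesis
  proof
    assume "psd_matrix 2 A"
    \<comment> \<open>The vector \<open>(- b, a)\<close> makes the completed square vanish and
      isolates the determinant.\<close>
    then have "s (\<lambda>i. if i = 0 then - b else a) \<in> \<real>\<^sub>\<ge>\<^sub>0"
      by (auto simp: psd_matrix_iff_nonneg_Reals s_def)
    then have "a * s (\<lambda>i. if i = 0 then - b else a) \<in> \<real>\<^sub>\<ge>\<^sub>0"
      using \<open>a > 0\<close> by (intro nonneg_Reals_mult_I) auto
    then have "0 \<le> (a * d - (cmod b)\<^sup>2) * a\<^sup>2"
      unfolding s by (simp add: complex_nonneg_Reals_iff)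
    then show "(cmod (A 0 1))\<^sup>2 \<le> a * d"
      using \<open>a > 0\<close> by (simp add: b_def zero_le_mult_iff)
  next
    assume "(cmod (A 0 1))\<^sup>2 \<le> a * d"
    then have "a * s c \<in> \<real>\<^sub>\<ge>\<^sub>0" for c
      unfolding s by (simp add: b_def del: of_real_add of_real_mult of_real_power of_real_diff)
    then have "s c \<in> \<real>\<^sub>\<ge>\<^sub>0" for c
      using \<open>a > 0\<close> by (auto simp: complex_nonneg_Reals_iff zero_le_mult_iff)
    then show "psd_matrix 2 A"
      by (simp add: psd_matrix_iff_nonneg_Reals s_def)
  qed
qed

text \<open>Replaces lists by indexed families, so that the sums can be rearranged without list
  indexing, and merges reality and sign into a single membership with good closure rules.\<close>

lemma psd_kernel_on_iff:
  "psd_kernel_on S L \<longleftrightarrow> (\<forall>(n::nat) x c. (\<forall>i<n. x i \<in> S) \<longrightarrow>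
     (\<Sum>i<n. \<Sum>j<n. L (x i) (x j) * c j * cnj (c i)) \<in> \<real>\<^sub>\<ge>\<^sub>0)" (is "_ = ?R")
proof
  assume L: "psd_kernel_on S L"
  show ?R
  proof (intro allI impI)
    fix n :: nat and x and c :: "nat \<Rightarrow> complex" assume "\<forall>i<n. x i \<in> S"
    then have "set (map x [0..<n]) \<subseteq> S"
      by auto
    then have "psd_matrix (length (map x [0..<n])) (\<lambda>i j. L (map x [0..<n] ! i) (map x [0..<n] ! j))"
      using L unfolding psd_kernel_on_def by blast
    then show "(\<Sum>i<n. \<Sum>j<n. L (x i) (x j) * c j * cnj (c i)) \<in> \<real>\<^sub>\<ge>\<^sub>0"
      by (simp add: psd_matrix_iff_nonneg_Reals)
  qed
next
  assume ?R
  then show "psd_kernel_on S L"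
    by (auto simp: psd_kernel_on_def psd_matrix_iff_nonneg_Reals subset_iff)
qed

lemma psd_kernel_on_cong:
  assumes "psd_kernel_on S L" "\<And>x y. x \<in> S \<Longrightarrow> y \<in> S \<Longrightarrow> L x y = L' x y"
  shows "psd_kernel_on S L'"
  unfolding psd_kernel_on_iff
proof (intro allI impI)
  fix n :: nat and x and c :: "nat \<Rightarrow> complex" assume x: "\<forall>i<n. x i \<in> S"
  have "(\<Sum>i<n. \<Sum>j<n. L' (x i) (x j) * c j * cnj (c i)) = (\<Sum>i<n. \<Sum>j<n. L (x i) (x j) * c j * cnj (c i))"
    using x assms(2) by (intro sum.cong refl) auto
  then show "(\<Sum>i<n. \<Sum>j<n. L' (x i) (x j) * c j * cnj (c i)) \<in> \<real>\<^sub>\<ge>\<^sub>0"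
    using assms(1) x by (simp add: psd_kernel_on_iff)
qed

lemma psd_kernel_on_add:
  assumes "psd_kernel_on S L" "psd_kernel_on S L'"
  shows "psd_kernel_on S (\<lambda>x y. L x y + L' x y)"
  using assms by (auto simp: psd_kernel_on_iff distrib_right sum.distrib)

lemma psd_kernel_on_cmult:
  assumes "psd_kernel_on S L" "0 \<le> a"
  shows "psd_kernel_on S (\<lambda>x y. complex_of_real a * L x y)"
  using assms by (auto simp: psd_kernel_on_iff mult.assoc sum_distrib_left [symmetric])

lemma psd_kernel_on_one: "psd_kernel_on S (\<lambda>x y. 1)"
proof -
  have "(\<Sum>i<n. \<Sum>j<n. c j * cnj (c i)) = complex_of_real ((cmod (\<Sum>i<n. c i))\<^sup>2)"
    for n :: nat and c
    unfolding complex_norm_square mult.commute [of _ "cnj _"]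
    by (simp add: sum_product)
  then show ?thesis
    by (simp add: psd_kernel_on_iff)
qed

text \<open>The weight is absorbed into the coefficients: use \<open>c i * cnj (f (x i))\<close> in
  place of \<open>c i\<close>.\<close>

lemma psd_kernel_on_weighted:
  assumes "psd_kernel_on S L"
  shows "psd_kernel_on S (\<lambda>x y. f x * cnj (f y) * L x y)"
  unfolding psd_kernel_on_iff
proof (intro allI impI)
  fix n :: nat and x and c :: "nat \<Rightarrow> complex" assume x: "\<forall>i<n. x i \<in> S"
  have "(\<Sum>i<n. \<Sum>j<n. L (x i) (x j) * (c j * cnj (f (x j))) * cnj (c i * cnj (f (x i)))) \<in> \<real>\<^sub>\<ge>\<^sub>0"
    using assms [unfolded psd_kernel_on_iff, THEN spec, THEN spec, THEN spec, THEN mp, OF x,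
        of "\<lambda>i. c i * cnj (f (x i))"] .
  then show "(\<Sum>i<n. \<Sum>j<n. f (x i) * cnj (f (x j)) * L (x i) (x j) * c j * cnj (c i)) \<in> \<real>\<^sub>\<ge>\<^sub>0"
    by (simp add: mult_ac)
qed

lemma geometric_deriv_sums_complex:
  fixes z :: complex
  assumes "cmod z < 1"
  shows "(\<lambda>n. of_nat (Suc n) * z ^ n) sums (1 / (1 - z)\<^sup>2)"
  using geometric_deriv_sums [OF assms] by simp

text \<open>Schur product with the Bergman kernel: expanding the latter as
  \<open>\<Sum>n. (n + 1) z\<^sup>n \<lambda>\<^sup>n\<close> (with \<open>\<lambda>\<close> conjugated) makes every summand a weighted copy of \<open>G\<close>.\<close>

lemma psd_kernel_on_divide_bergman:
  assumes G: "psd_kernel_on S G" and S: "S \<subseteq> unit_disk"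
  shows "psd_kernel_on S (\<lambda>z l. G z l / (1 - z * cnj l)\<^sup>2)"
  unfolding psd_kernel_on_iff
proof (intro allI impI)
  fix n :: nat and x and c :: "nat \<Rightarrow> complex" assume x: "\<forall>i<n. x i \<in> S"
  \<comment> \<open>The contribution of the \<open>k\<close>-th power to the quadratic form; it is a
    nonnegative real by weighting \<open>G\<close> with \<open>z ^ k\<close>.\<close>
  define T where "T k = of_nat (Suc k) *
    (\<Sum>i<n. \<Sum>j<n. ((x i) ^ k * cnj ((x j) ^ k) * G (x i) (x j)) * c j * cnj (c i))" for k
  have "T k \<in> \<real>\<^sub>\<ge>\<^sub>0" for k
    unfolding T_def
    using psd_kernel_on_weighted [OF G, of "\<lambda>z. z ^ k"] x
    by (intro nonneg_Reals_mult_I) (auto simp: psd_kernel_on_iff simp del: of_nat_Suc)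
  then have T: "Re (T k) \<ge> 0" "Im (T k) = 0" for k
    by (auto simp: complex_nonneg_Reals_iff)
  have "(\<lambda>k. \<Sum>i<n. \<Sum>j<n. (of_nat (Suc k) * (x i * cnj (x j)) ^ k) * (G (x i) (x j) * c j * cnj (c i)))
      sums (\<Sum>i<n. \<Sum>j<n. (1 / (1 - x i * cnj (x j))\<^sup>2) * (G (x i) (x j) * c j * cnj (c i)))"
  proof (intro sums_sum sums_mult2 geometric_deriv_sums_complex)
    fix i j assume "i \<in> {..<n}" "j \<in> {..<n}"
    then have "cmod (x i) < 1" "cmod (x j) < 1" using x S by auto
    then show "cmod (x i * cnj (x j)) < 1"
      by (simp add: norm_mult) (metis mult_strict_mono' norm_ge_zero mult_1)
  qed
  also have "(\<lambda>k. \<Sum>i<n. \<Sum>j<n. (of_nat (Suc k) * (x i * cnj (x j)) ^ k) * (G (x i) (x j) * c j * cnj (c i))) = T"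
    by (auto simp: T_def sum_distrib_left power_mult_distrib mult_ac simp del: of_nat_Suc intro!: sum.cong)
  also have "(\<Sum>i<n. \<Sum>j<n. (1 / (1 - x i * cnj (x j))\<^sup>2) * (G (x i) (x j) * c j * cnj (c i))) =
     (\<Sum>i<n. \<Sum>j<n. G (x i) (x j) / (1 - x i * cnj (x j))\<^sup>2 * c j * cnj (c i))" (is "_ = ?s")
    by (simp add: mult_ac)
  finally have "T sums ?s" .
  \<comment> \<open>Being a nonnegative real survives the limit, taken separately in real and
    imaginary parts.\<close>
  note sums = sums_Re [OF this] sums_Im [OF this]
  have "Re ?s \<ge> 0"
    by (rule sums_le [OF _ sums_zero sums(1)]) (rule T)
  moreover have "Im ?s = 0"
    using sums(2) unfolding T(2) by (rule sums_unique2) (rule sums_zero)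
  ultimately show "?s \<in> \<real>\<^sub>\<ge>\<^sub>0"
    by (simp add: complex_nonneg_Reals_iff)
qed

section \<open>The determinant conditions\<close>

text \<open>The binomial expansion of the square; the factor \<open>sqrt 2\<close> in
  \<open>Phi\<close> produces its middle term. Hence the denominator of the kernel is the reciprocal
  of the Bergman kernel.\<close>

lemma one_minus_inner_K_Phi: "1 - inner_K (Phi z) (Phi l) = (1 - z * cnj l)\<^sup>2"
proof -
  have "complex_of_real (sqrt 2) * complex_of_real (sqrt 2) = 2"
    by (metis abs_numeral of_real_mult of_real_numeral real_sqrt_mult_self)
  then have "complex_of_real (sqrt 2) * z * (complex_of_real (sqrt 2) * cnj l) = 2 * z * cnj l"
    by (metis mult.assoc mult.left_commute)
  then show ?thesis
    by (simp add: inner_K_def Phi_def power2_eq_square algebra_simps)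
qed

lemma one_minus_mult_cnj_ne_0:
  assumes "z \<in> unit_disk" "l \<in> unit_disk"
  shows "1 - z * cnj l \<noteq> 0"
proof
  assume "1 - z * cnj l = 0"
  then have "cmod z * cmod l = 1"
    by (metis complex_mod_cnj norm_mult norm_one right_minus_eq)
  moreover have "cmod z * cmod l < 1 * 1"
    using assms by (intro mult_strict_mono') auto
  ultimately show False by simp
qed

text \<open>This is \<open>1 / (1 - d\<^sup>2)\<close> with \<open>d\<close> the pseudohyperbolic
  distance of the two points. It is the common quantity in which all the determinant conditions are
  expressed.\<close>

definition gram_ratio :: "complex \<Rightarrow> complex \<Rightarrow> real" where
  "gram_ratio z l = (cmod (1 - z * cnj l))\<^sup>2 / ((1 - (cmod z)\<^sup>2) * (1 - (cmod l)\<^sup>2))"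

lemma one_minus_cmod_sq_pos: "z \<in> unit_disk \<Longrightarrow> 0 < 1 - (cmod z)\<^sup>2"
  by (simp add: abs_square_less_1)

lemma gram_ratio_pos:
  assumes "z \<in> unit_disk" "l \<in> unit_disk"
  shows "0 < gram_ratio z l"
  using one_minus_mult_cnj_ne_0 [OF assms] assms one_minus_cmod_sq_pos
  by (simp add: gram_ratio_def)

text \<open>Entrywise powers raise both sides of the determinant inequality to the same power, and
  both sides are nonnegative. The exponent 1 gives the Pick matrix, the exponent 2 gives
  \<open>M_Phi\<close>.\<close>

lemma psd_pick_power_iff:
  assumes D: "l\<^sub>1 \<in> unit_disk" "l\<^sub>2 \<in> unit_disk" "w\<^sub>1 \<in> unit_disk" "w\<^sub>2 \<in> unit_disk" and "0 < k"
  shows "psd_matrix 2 (\<lambda>i j. pick_matrix [l\<^sub>1, l\<^sub>2] [w\<^sub>1, w\<^sub>2] i j ^ k) \<longleftrightarrow>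
    gram_ratio w\<^sub>1 w\<^sub>2 \<le> gram_ratio l\<^sub>1 l\<^sub>2"
proof -
  let ?P = "pick_matrix [l\<^sub>1, l\<^sub>2] [w\<^sub>1, w\<^sub>2]"
  let ?n = "\<lambda>z. 1 - (cmod z)\<^sup>2"
  note pos = D [THEN one_minus_cmod_sq_pos] gram_ratio_pos [OF D(1,2)] gram_ratio_pos [OF D(3,4)]
  have sq: "1 - z * cnj z = complex_of_real (?n z)" for z
    by (simp add: complex_norm_square del: of_real_power)
  have P: "?P 0 0 = complex_of_real (?n w\<^sub>1 / ?n l\<^sub>1)" "?P 1 1 = complex_of_real (?n w\<^sub>2 / ?n l\<^sub>2)"
    unfolding of_real_divide sq [symmetric] by (simp_all add: pick_matrix_def)
  have P': "?P 1 0 = cnj (?P 0 1)"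
    by (simp add: pick_matrix_def mult.commute)
  have "psd_matrix 2 (\<lambda>i j. ?P i j ^ k) \<longleftrightarrow>
      (cmod (?P 0 1 ^ k))\<^sup>2 \<le> (?n w\<^sub>1 / ?n l\<^sub>1) ^ k * (?n w\<^sub>2 / ?n l\<^sub>2) ^ k"
  proof (rule psd_matrix_2_iff)
    show "0 < (?n w\<^sub>1 / ?n l\<^sub>1) ^ k"
      using pos by simp
  qed (simp_all only: P P' of_real_power complex_cnj_power)
  also have "\<dots> \<longleftrightarrow> ((cmod (?P 0 1))\<^sup>2) ^ k \<le> (?n w\<^sub>1 / ?n l\<^sub>1 * (?n w\<^sub>2 / ?n l\<^sub>2)) ^ k"
    by (simp only: norm_power power_mult_distrib power_mult [symmetric] mult.commute)
  also have "\<dots> \<longleftrightarrow> (cmod (?P 0 1))\<^sup>2 \<le> ?n w\<^sub>1 / ?n l\<^sub>1 * (?n w\<^sub>2 / ?n l\<^sub>2)"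
    using pos \<open>0 < k\<close> by (intro power_mono_iff) auto
  also have "\<dots> \<longleftrightarrow> gram_ratio w\<^sub>1 w\<^sub>2 \<le> gram_ratio l\<^sub>1 l\<^sub>2"
    using pos one_minus_mult_cnj_ne_0 [OF D(1,2)]
    by (simp add: gram_ratio_def pick_matrix_def norm_divide power_divide divide_simps mult_ac)
  finally show ?thesis .
qed

text \<open>The Bergman kernel is the square of \<open>1 / (1 - z * cnj l)\<close>, so its
  normalised squared modulus is the square of the one for that kernel.\<close>

lemma bergman_dist_eq:
  assumes "z \<in> unit_disk" "l \<in> unit_disk"
  shows "bergman_dist z l = sqrt (1 - (1 / gram_ratio z l)\<^sup>2)"
proof -
  have "bergman_kernel z z = complex_of_real (1 / (1 - (cmod z)\<^sup>2)\<^sup>2)" for z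
    using complex_norm_square [of z]
    by (simp add: bergman_kernel_def mult.commute)
  then have "Re (bergman_kernel z z) = 1 / (1 - (cmod z)\<^sup>2)\<^sup>2" for z
    by (metis Re_complex_of_real)
  then show ?thesis
    by (simp add: bergman_dist_def bergman_kernel_def gram_ratio_def norm_divide norm_power
        power_divide power_mult_distrib mult.commute)
qed

lemma bergman_dist_le_iff:
  assumes D: "l\<^sub>1 \<in> unit_disk" "l\<^sub>2 \<in> unit_disk" "w\<^sub>1 \<in> unit_disk" "w\<^sub>2 \<in> unit_disk"
  shows "bergman_dist w\<^sub>1 w\<^sub>2 \<le> bergman_dist l\<^sub>1 l\<^sub>2 \<longleftrightarrow> gram_ratio w\<^sub>1 w\<^sub>2 \<le> gram_ratio l\<^sub>1 l\<^sub>2"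
proof -
  note pos = gram_ratio_pos [OF D(1,2)] gram_ratio_pos [OF D(3,4)]
  have "bergman_dist w\<^sub>1 w\<^sub>2 \<le> bergman_dist l\<^sub>1 l\<^sub>2 \<longleftrightarrow> (1 / gram_ratio l\<^sub>1 l\<^sub>2)\<^sup>2 \<le> (1 / gram_ratio w\<^sub>1 w\<^sub>2)\<^sup>2"
    using D by (simp add: bergman_dist_eq)
  also have "\<dots> \<longleftrightarrow> 1 / gram_ratio l\<^sub>1 l\<^sub>2 \<le> 1 / gram_ratio w\<^sub>1 w\<^sub>2"
    using pos by (intro power_mono_iff) auto
  also have "\<dots> \<longleftrightarrow> gram_ratio w\<^sub>1 w\<^sub>2 \<le> gram_ratio l\<^sub>1 l\<^sub>2"
    using pos by (simp add: divide_simps)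
  finally show ?thesis .
qed

section \<open>Disk automorphisms and hyperbolic midpoints\<close>

definition blaschke :: "complex \<Rightarrow> complex \<Rightarrow> complex" where
  "blaschke m z = (z - m) / (1 - cnj m * z)"

text \<open>Rests on the identity \<open>|1 - m cnj z|\<^sup>2 - |z - m|\<^sup>2 = (1 - |m|\<^sup>2)
  (1 - |z|\<^sup>2)\<close>.\<close>

lemma cmod_blaschke:
  assumes "z \<in> unit_disk" "m \<in> unit_disk"
  shows "(cmod (blaschke m z))\<^sup>2 = 1 - 1 / gram_ratio m z"
proof -
  have nz: "1 - m * cnj z \<noteq> 0"
    using one_minus_mult_cnj_ne_0 assms by blast
  have eq: "cmod (1 - m * cnj z) = cmod (1 - cnj m * z)"
    by (metis complex_cnj_cnj complex_cnj_diff complex_cnj_mult complex_cnj_one complex_mod_cnj)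
  have "complex_of_real ((cmod (z - m))\<^sup>2) =
      complex_of_real ((cmod (1 - m * cnj z))\<^sup>2 - (1 - (cmod m)\<^sup>2) * (1 - (cmod z)\<^sup>2))"
    by (simp add: complex_norm_square algebra_simps del: of_real_power)
  then have "(cmod (z - m))\<^sup>2 = (cmod (1 - m * cnj z))\<^sup>2 - (1 - (cmod m)\<^sup>2) * (1 - (cmod z)\<^sup>2)"
    using of_real_eq_iff by blast
  then show ?thesis
    using nz unfolding blaschke_def gram_ratio_def norm_divide eq [symmetric]
    by (simp add: power_divide diff_divide_distrib)
qed

lemma blaschke_in_unit_disk:
  assumes "z \<in> unit_disk" "m \<in> unit_disk"
  shows "blaschke m z \<in> unit_disk"
proof -
  have "(cmod (blaschke m z))\<^sup>2 < 1"
    using gram_ratio_pos [OF assms(2,1)] cmod_blaschke [OF assms] by simp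
  then show ?thesis
    by (simp add: abs_square_less_1)
qed

lemma blaschke_uminus_inverse:
  assumes "z \<in> unit_disk" "m \<in> unit_disk"
  shows "blaschke (- m) (blaschke m z) = z"
proof -
  have nz: "1 - cnj m * z \<noteq> 0" "1 - m * cnj m \<noteq> 0"
    using one_minus_mult_cnj_ne_0 [of z m] one_minus_mult_cnj_ne_0 [of m m] assms
    by (auto simp: mult.commute)
  have 1: "(z - m) / (1 - cnj m * z) + m = z * (1 - m * cnj m) / (1 - cnj m * z)"
    using nz by (simp add: divide_simps) (simp add: algebra_simps)
  have 2: "1 + cnj m * ((z - m) / (1 - cnj m * z)) = (1 - m * cnj m) / (1 - cnj m * z)"
    using nz by (simp add: divide_simps) (simp add: algebra_simps)
  show ?thesis
    using nz unfolding blaschke_def complex_cnj_minus minus_mult_minus diff_minus_eq_add mult_minus_left 1 2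
    by simp
qed

text \<open>The point \<open>m\<close> is the hyperbolic midpoint of 0 and \<open>p\<close>, so
  \<open>blaschke m\<close> moves these two points to the symmetric positions \<open>- m\<close> and
  \<open>m\<close>. The formula for \<open>cmod p\<close> is the addition formula of tanh for a
  doubled argument.\<close>

lemma hyperbolic_midpoint:
  assumes "p \<in> unit_disk"
  obtains m where "m \<in> unit_disk" "blaschke m p = m" "p = 0 \<longleftrightarrow> m = 0"
    "cmod p = 2 * cmod m / (1 + (cmod m)\<^sup>2)"
proof
  define r where "r = sqrt (1 - (cmod p)\<^sup>2)"
  \<comment> \<open>The smaller root of \<open>|p| (1 + |m|\<^sup>2) = 2 |m|\<close>, with the
    argument of \<open>p\<close>; in this form it also covers \<open>p = 0\<close>.\<close>
  define m where "m = p / complex_of_real (1 + r)"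
  have p: "0 < 1 - (cmod p)\<^sup>2" using one_minus_cmod_sq_pos [OF assms] .
  then have r: "0 < r" and r2: "(cmod p)\<^sup>2 = 1 - r\<^sup>2" by (auto simp: r_def)
  have cm: "cmod m = cmod p / (1 + r)"
    using r by (simp add: m_def norm_divide del: of_real_add)
  have "cmod p < 1" using assms by simp
  then have "cmod p < 1 + r" using r by simp
  then show m: "m \<in> unit_disk"
    using r by (simp add: cm)
  show "p = 0 \<longleftrightarrow> m = 0"
    using r by (auto simp: m_def simp del: of_real_add)
  have "(1 - r) * (1 + r) = 1 - r\<^sup>2"
    by (simp add: algebra_simps power2_eq_square)
  then have m2: "(cmod m)\<^sup>2 = (1 - r) / (1 + r)"
    using r unfolding cm power_divide r2 by (simp add: divide_simps power2_eq_square)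
  then have mm: "1 + (cmod m)\<^sup>2 = 2 / (1 + r)" and m2': "(cmod m)\<^sup>2 * (1 + r) = 1 - r"
    using r by (simp_all add: divide_simps distrib_right)
  show "cmod p = 2 * cmod m / (1 + (cmod m)\<^sup>2)"
    using r unfolding mm by (simp add: cm)
  have pm: "p = m * complex_of_real (1 + r)"
    using r by (simp add: m_def del: of_real_add)
  have "cnj m * p = m * cnj m * complex_of_real (1 + r)"
    unfolding pm by (simp only: mult_ac)
  also have "\<dots> = complex_of_real ((cmod m)\<^sup>2 * (1 + r))"
    by (simp only: of_real_mult complex_norm_square)
  also have "\<dots> = 1 - complex_of_real r"
    by (simp only: m2' of_real_diff of_real_1)
  finally have "1 - cnj m * p = complex_of_real r" by simp
  moreover have "p - m = m * complex_of_real r"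
    unfolding pm by (simp add: distrib_left)
  ultimately show "blaschke m p = m"
    using r by (simp add: blaschke_def)
qed

section \<open>Expansive matrices\<close>

definition hform :: "complex^3 \<Rightarrow> complex^3 \<Rightarrow> complex" where
  "hform x y = x$1 * cnj (y$1) - x$2 * cnj (y$2) + x$3 * cnj (y$3)"

definition aff :: "complex \<times> complex \<Rightarrow> complex^3" where
  "aff z = vector [1, fst z, snd z]"

abbreviation lift :: "complex \<Rightarrow> complex^3" where
  "lift z \<equiv> aff (Phi z)"

text \<open>Positivity of \<open>s\<close> makes positive vectors go to positive vectors;
  invertibility will yield coprime numerators and denominators.\<close>

definition expansive :: "real \<Rightarrow> complex^3^3 \<Rightarrow> bool" where
  "expansive s A \<longleftrightarrow> 0 < s \<and> invertible A \<and>
    (\<forall>v. s * Re (hform v v) \<le> Re (hform (A *v v) (A *v v)))"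

text \<open>Equality of points in the projective plane. The nonzero factor keeps the image in the
  affine chart, where the rational map is defined.\<close>

definition carries :: "complex^3^3 \<Rightarrow> complex^3 \<Rightarrow> complex^3 \<Rightarrow> bool" where
  "carries A x y \<longleftrightarrow> (\<exists>a. a \<noteq> 0 \<and> A *v x = a *s y)"

lemma hform_smult: "hform (a *s x) (b *s y) = a * cnj b * hform x y"
  by (simp add: hform_def algebra_simps)

lemma hform_self: "hform x x = complex_of_real ((cmod (x$1))\<^sup>2 - (cmod (x$2))\<^sup>2 + (cmod (x$3))\<^sup>2)"
  by (simp only: hform_def of_real_add of_real_diff complex_norm_square)

lemma hform_aff: "hform (aff x) (aff y) = 1 - inner_K x y"
  by (simp add: hform_def aff_def inner_K_def vector_3)

lemma carries_mult:
  assumes "carries A x y" "carries B y z"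
  shows "carries (B ** A) x z"
proof -
  obtain a b where "a \<noteq> 0" "A *v x = a *s y" "b \<noteq> 0" "B *v y = b *s z"
    using assms by (auto simp: carries_def)
  then have "(B ** A) *v x = (a * b) *s z"
    by (simp add: matrix_vector_mul_assoc [symmetric] vector_scalar_commute vector_smult_assoc)
  then show ?thesis
    using \<open>a \<noteq> 0\<close> \<open>b \<noteq> 0\<close> unfolding carries_def by (intro exI [of _ "a * b"]) simp
qed

lemma expansive_mult:
  assumes "expansive s A" "expansive t B"
  shows "expansive (t * s) (B ** A)"
proof -
  have "t * s * Re (hform v v) \<le> Re (hform ((B ** A) *v v) ((B ** A) *v v))" for v
  proof -
    have "t * (s * Re (hform v v)) \<le> t * Re (hform (A *v v) (A *v v))"
      using assms by (intro mult_left_mono) (auto simp: expansive_def)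
    also have "\<dots> \<le> Re (hform (B *v (A *v v)) (B *v (A *v v)))"
      using assms by (simp add: expansive_def)
    finally show ?thesis
      by (simp add: matrix_vector_mul_assoc mult.assoc)
  qed
  then show ?thesis
    using assms by (simp add: expansive_def invertible_mult)
qed

text \<open>The action of the matrix with rows \<open>(1, - m)\<close> and \<open>(- cnj m, 1)\<close> on the vectors
  \<open>(v\<^sup>2, \<surd>2 u v, u\<^sup>2)\<close>, where \<open>z = u / v\<close>.\<close>

definition moebius_mat :: "complex \<Rightarrow> complex^3^3" where
  "moebius_mat m = (let r = complex_of_real (sqrt 2) in vector
     [vector [1, - r * cnj m, (cnj m)\<^sup>2],
      vector [- r * m, 1 + m * cnj m, - r * cnj m],
      vector [m\<^sup>2, - r * m, 1]])"

lemma sqrt2_mult_self: "complex_of_real (sqrt 2) * complex_of_real (sqrt 2) = 2"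
  by (metis abs_numeral of_real_mult of_real_numeral real_sqrt_mult_self)

lemma moebius_mat_mult:
  "(moebius_mat m *v v) $ 1 = v$1 - complex_of_real (sqrt 2) * cnj m * v$2 + (cnj m)\<^sup>2 * v$3"
  "(moebius_mat m *v v) $ 2 = - complex_of_real (sqrt 2) * m * v$1 + (1 + m * cnj m) * v$2 - complex_of_real (sqrt 2) * cnj m * v$3"
  "(moebius_mat m *v v) $ 3 = m\<^sup>2 * v$1 - complex_of_real (sqrt 2) * m * v$2 + v$3"
  by (simp_all add: moebius_mat_def Let_def matrix_vector_mult_def sum_3 vector_3)

text \<open>Conjugates are replaced by independent variables, which turns invariance of the form up
  to a factor into a ring identity whose only relation is \<open>r * r = 2\<close>.\<close>

lemma moebius_form_identity:
  fixes r :: "'a :: idom"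
  assumes "r * r = 2"
  shows "(x1 - r * n * x2 + n^2 * x3) * (y1 - r * m * y2 + m^2 * y3)
    - (- r * m * x1 + (1 + m * n) * x2 - r * n * x3) * (- r * n * y1 + (1 + n * m) * y2 - r * m * y3)
    + (m^2 * x1 - r * m * x2 + x3) * (n^2 * y1 - r * n * y2 + y3)
    = (1 - m * n)^2 * (x1 * y1 - x2 * y2 + x3 * y3)"
proof -
  have r: "r * (r * x) = 2 * x" for x
    using assms by (simp add: mult.assoc [symmetric])
  show ?thesis
    by (simp add: power2_eq_square algebra_simps assms r)
qed

lemma hform_moebius_mat:
  "hform (moebius_mat m *v v) (moebius_mat m *v v) = complex_of_real ((1 - (cmod m)\<^sup>2)\<^sup>2) * hform v v"
proof -
  have "complex_of_real (1 - (cmod m)\<^sup>2) = 1 - m * cnj m"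
    by (simp only: of_real_diff of_real_1 complex_norm_square)
  then have "complex_of_real ((1 - (cmod m)\<^sup>2)\<^sup>2) = (1 - m * cnj m)\<^sup>2"
    by (metis of_real_power)
  then show ?thesis
    using moebius_form_identity [OF sqrt2_mult_self, of "v$1" "cnj m" "v$2" "v$3" "cnj (v$1)" m "cnj (v$2)" "cnj (v$3)"]
    by (simp add: hform_def moebius_mat_mult)
qed

text \<open>The form is multiplied by exactly this factor, so the inequality is an equality. The
  determinant is the cube of the determinant of the underlying 2 by 2 matrix, as for every symmetric
  square.\<close>

lemma expansive_moebius_mat:
  assumes "m \<in> unit_disk"
  shows "expansive ((1 - (cmod m)\<^sup>2)\<^sup>2) (moebius_mat m)"
proof -
  have det: "r * r = 2 \<Longrightarrow> 1 * (1 + m * n) * 1 + (- r * n) * (- r * n) * m^2 + n^2 * (- r * m) * (- r * m)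
      - 1 * (- r * n) * (- r * m) - (- r * n) * (- r * m) * 1 - n^2 * (1 + m * n) * m^2 = (1 - m * n)^3"
    for r n :: complex
  proof -
    assume r: "r * r = 2"
    then have "r * (r * x) = 2 * x" for x
      by (simp add: mult.assoc [symmetric])
    with r show ?thesis
      by (simp add: power2_eq_square power3_eq_cube algebra_simps)
  qed
  have "det (moebius_mat m) = (1 - m * cnj m) ^ 3"
    using det [OF sqrt2_mult_self, of "cnj m"]
    by (simp add: det_3 moebius_mat_def Let_def vector_3)
  then have "invertible (moebius_mat m)"
    using one_minus_mult_cnj_ne_0 [OF assms assms] by (simp add: invertible_det_nz)
  then show ?thesis
    using one_minus_cmod_sq_pos [OF assms] by (simp add: expansive_def hform_moebius_mat)
qed

lemma carries_moebius_mat: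
  assumes "m \<in> unit_disk" "z \<in> unit_disk"
  shows "carries (moebius_mat m) (lift z) (lift (blaschke m z))"
proof -
  define d where "d = 1 - cnj m * z"
  define b where "b = blaschke m z"
  have d: "d \<noteq> 0"
    using one_minus_mult_cnj_ne_0 [OF assms(2,1)] by (simp add: d_def mult.commute)
  then have "d * b = z - m"
    by (simp add: b_def blaschke_def d_def)
  note eq = this d_def sqrt2_mult_self
  \<comment> \<open>In homogeneous coordinates the transformation takes \<open>(1, z)\<close> to
    \<open>(d, z - m) = d (1, b)\<close>; squaring gives the factor
    \<open>d\<^sup>2\<close>.\<close>
  have "moebius_mat m *v lift z = d\<^sup>2 *s lift b"
    unfolding vec_eq_iff forall_3 moebius_mat_mult aff_def Phi_def vector_smult_component vector_3 fst_conv snd_conv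
  proof (intro conjI)
    show "1 - complex_of_real (sqrt 2) * cnj m * (complex_of_real (sqrt 2) * z) + (cnj m)\<^sup>2 * z\<^sup>2 = d\<^sup>2 * 1"
      using eq by algebra
    show "- complex_of_real (sqrt 2) * m * 1 + (1 + m * cnj m) * (complex_of_real (sqrt 2) * z) -
      complex_of_real (sqrt 2) * cnj m * z\<^sup>2 = d\<^sup>2 * (complex_of_real (sqrt 2) * b)"
      using eq by algebra
    show "m\<^sup>2 * 1 - complex_of_real (sqrt 2) * m * (complex_of_real (sqrt 2) * z) + z\<^sup>2 = d\<^sup>2 * b\<^sup>2"
      using eq by algebra
  qed
  then show ?thesis
    using d unfolding carries_def b_def by (intro exI [of _ "d\<^sup>2"]) simp
qed

text \<open>First \<open>blaschke z\<^sub>1\<close> sends \<open>z\<^sub>1\<close> to 0, then the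
  midpoint map makes the pair symmetric. \<open>A\<close> will be used on the source pair and
  \<open>B\<close>, built from the inverse transformations, on the target pair.\<close>

lemma normalise_pair:
  assumes "z\<^sub>1 \<in> unit_disk" "z\<^sub>2 \<in> unit_disk" "z\<^sub>1 \<noteq> z\<^sub>2"
  obtains m A B s t where "m \<in> unit_disk" "m \<noteq> 0"
    "1 - 1 / gram_ratio z\<^sub>1 z\<^sub>2 = (2 * cmod m / (1 + (cmod m)\<^sup>2))\<^sup>2"
    "expansive s A" "carries A (lift z\<^sub>1) (lift (- m))" "carries A (lift z\<^sub>2) (lift m)"
    "expansive t B" "carries B (lift (- m)) (lift z\<^sub>1)" "carries B (lift m) (lift z\<^sub>2)"
proof -
  define p where "p = blaschke z\<^sub>1 z\<^sub>2"
  have p: "p \<in> unit_disk"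
    using assms blaschke_in_unit_disk by (simp add: p_def)
  have "p \<noteq> 0"
    using one_minus_mult_cnj_ne_0 [of z\<^sub>2 z\<^sub>1] assms by (auto simp: p_def blaschke_def mult.commute)
  obtain m where m: "m \<in> unit_disk" "blaschke m p = m" "p = 0 \<longleftrightarrow> m = 0"
    "cmod p = 2 * cmod m / (1 + (cmod m)\<^sup>2)"
    using hyperbolic_midpoint [OF p] .
  have z1: "blaschke z\<^sub>1 z\<^sub>1 = 0" and m0: "blaschke m 0 = - m" and "0 \<in> unit_disk"
    and neg: "- m \<in> unit_disk" "- z\<^sub>1 \<in> unit_disk"
    using m assms by (simp_all add: blaschke_def)
  have inv: "carries (moebius_mat (- c)) (lift (blaschke c z)) (lift z)"
    if "c \<in> unit_disk" "z \<in> unit_disk" for c z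
    using carries_moebius_mat [of "- c" "blaschke c z"] blaschke_in_unit_disk [OF that(2,1)] that
    by (simp add: blaschke_uminus_inverse)
  show ?thesis
  proof (rule that [of m])
    show "1 - 1 / gram_ratio z\<^sub>1 z\<^sub>2 = (2 * cmod m / (1 + (cmod m)\<^sup>2))\<^sup>2"
      using cmod_blaschke [OF assms(2,1)] by (simp add: p_def [symmetric] m(4))
    show "carries (moebius_mat m ** moebius_mat z\<^sub>1) (lift z\<^sub>1) (lift (- m))"
      using carries_moebius_mat [OF assms(1,1)] carries_moebius_mat [OF m(1) \<open>0 \<in> unit_disk\<close>]
      by (intro carries_mult) (simp_all add: z1 m0)
    show "carries (moebius_mat m ** moebius_mat z\<^sub>1) (lift z\<^sub>2) (lift m)"
      using carries_moebius_mat [OF assms(1,2)] carries_moebius_mat [OF m(1) p]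
      by (intro carries_mult) (simp_all add: p_def [symmetric] m)
    show "carries (moebius_mat (- z\<^sub>1) ** moebius_mat (- m)) (lift (- m)) (lift z\<^sub>1)"
      using inv [OF assms(1,1)] inv [OF m(1) \<open>0 \<in> unit_disk\<close>]
      by (intro carries_mult) (simp_all add: z1 m0)
    show "carries (moebius_mat (- z\<^sub>1) ** moebius_mat (- m)) (lift m) (lift z\<^sub>2)"
      using inv [OF assms(1,2)] inv [OF m(1) p]
      by (intro carries_mult) (simp_all add: p_def [symmetric] m)
  \<comment> \<open>The factors \<open>s\<close> and \<open>t\<close> are still open here; composing
    the Moebius matrices determines them.\<close>
  qed (use m \<open>p \<noteq> 0\<close> in \<open>simp_all add: expansive_mult expansive_moebius_mat assms neg del: mem_ball\<close>,
       (rule expansive_mult expansive_moebius_mat assms m neg)+)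
qed

text \<open>On the span of the first and third coordinates, where the form is positive definite,
  the matrix is a unitary times a scalar taking \<open>(1, m\<^sup>2)\<close> to \<open>(1, n\<^sup>2)\<close>.\<close>

definition shrink_mat :: "complex \<Rightarrow> complex \<Rightarrow> complex^3^3" where
  "shrink_mat m n =
    (let k = 1 + m\<^sup>2 * (cnj m)\<^sup>2; a = (1 + (cnj n)\<^sup>2 * m\<^sup>2) / k; b = (n\<^sup>2 - m\<^sup>2) / k in
     vector [vector [a, 0, - cnj b], vector [0, n / m, 0], vector [b, 0, cnj a]])"

text \<open>The positive part of the form is scaled by exactly \<open>s\<close>, the squared norm of
  \<open>(1, n\<^sup>2)\<close> over that of \<open>(1, m\<^sup>2)\<close>, and the negative part by
  \<open>|n / m|\<^sup>2\<close>, which is at most \<open>s\<close>. Both signs are handled at once,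
  since only the middle coordinate of \<open>lift\<close> is odd.\<close>

lemma shrink_mat:
  assumes n: "0 < cmod n" "cmod n \<le> cmod m" and m: "cmod m < 1"
  shows "expansive ((1 + cmod n ^ 4) / (1 + cmod m ^ 4)) (shrink_mat m n)" (is "expansive ?s _")
    and "carries (shrink_mat m n) (lift m) (lift n)"
    and "carries (shrink_mat m n) (lift (- m)) (lift (- n))"
proof -
  define k where "k = 1 + m\<^sup>2 * (cnj m)\<^sup>2"
  define a where "a = (1 + (cnj n)\<^sup>2 * m\<^sup>2) / k"
  define b where "b = (n\<^sup>2 - m\<^sup>2) / k"
  have four: "z\<^sup>2 * (cnj z)\<^sup>2 = complex_of_real (cmod z ^ 4)" for z
  proof -
    have "complex_of_real (cmod z ^ 4) = (complex_of_real ((cmod z)\<^sup>2))\<^sup>2"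
      by (simp flip: power_mult)
    then show ?thesis
      by (simp only: complex_norm_square power_mult_distrib)
  qed
  have k: "k = complex_of_real (1 + cmod m ^ 4)"
    unfolding k_def four by simp
  have "0 < 1 + cmod m ^ 4"
    by (simp add: add_pos_nonneg)
  then have "k \<noteq> 0" "cnj k = k"
    unfolding k by (metis of_real_eq_0_iff less_irrefl, simp)
  have ak: "a * k = 1 + (cnj n)\<^sup>2 * m\<^sup>2" "cnj a * k = 1 + n\<^sup>2 * (cnj m)\<^sup>2"
    and bk: "b * k = n\<^sup>2 - m\<^sup>2" "cnj b * k = (cnj n)\<^sup>2 - (cnj m)\<^sup>2"
    using \<open>k \<noteq> 0\<close> \<open>cnj k = k\<close> by (simp_all add: a_def b_def)
  have S: "shrink_mat m n = vector [vector [a, 0, - cnj b], vector [0, n / m, 0], vector [b, 0, cnj a]]"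
    by (simp add: shrink_mat_def Let_def a_def b_def k_def)
  \<comment> \<open>With \<open>u = m\<^sup>2\<close> and \<open>v = n\<^sup>2\<close> this is
    \<open>|1 + u cnj v|\<^sup>2 + |v - u|\<^sup>2 = (1 + |u|\<^sup>2) (1 +
    |v|\<^sup>2)\<close>.\<close>
  have "(a * cnj a + b * cnj b) * k = 1 + n\<^sup>2 * (cnj n)\<^sup>2"
  proof -
    have "((a * cnj a + b * cnj b) * k) * k = (a * k) * (cnj a * k) + (b * k) * (cnj b * k)"
      by (simp add: algebra_simps)
    also have "\<dots> = (1 + n\<^sup>2 * (cnj n)\<^sup>2) * k"
      unfolding ak bk unfolding k_def by (simp add: algebra_simps)
    finally show ?thesis
      using \<open>k \<noteq> 0\<close> by simp
  qed
  then have "a * cnj a + b * cnj b = (1 + n\<^sup>2 * (cnj n)\<^sup>2) / k"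
    using \<open>k \<noteq> 0\<close> by (simp add: nonzero_eq_divide_eq)
  also have "\<dots> = complex_of_real ?s"
    unfolding four k by simp
  finally have ab: "a * cnj a + b * cnj b = complex_of_real ?s" .
  then have "complex_of_real ((cmod a)\<^sup>2 + (cmod b)\<^sup>2) = complex_of_real ?s"
    by (simp only: of_real_add complex_norm_square)
  then have s: "(cmod a)\<^sup>2 + (cmod b)\<^sup>2 = ?s"
    by (simp only: of_real_eq_iff)
  have mult: "shrink_mat m n *v v = vector [a * v$1 - cnj b * v$3, n / m * v$2, b * v$1 + cnj a * v$3]" for v
    by (simp add: vec_eq_iff forall_3 S matrix_vector_mult_def sum_3 vector_3)
  have "m \<noteq> 0" "n \<noteq> 0" using n by auto
  have "(cmod (n / m))\<^sup>2 \<le> ?s"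
  proof -
    \<comment> \<open>The difference of the two sides after cross-multiplication, in factored
      form.\<close>
    have "0 \<le> ((cmod m)\<^sup>2 - (cmod n)\<^sup>2) * (1 - (cmod n)\<^sup>2 * (cmod m)\<^sup>2)"
      using n m by (intro mult_nonneg_nonneg) (simp_all add: power_mono mult_le_one power_le_one)
    then show ?thesis
      using \<open>0 < 1 + cmod m ^ 4\<close> \<open>m \<noteq> 0\<close>
      by (simp add: norm_divide power_divide frac_le_eq divide_simps) (simp add: algebra_simps eval_nat_numeral)
  qed
  have form: "Re (hform (shrink_mat m n *v v) (shrink_mat m n *v v)) =
      ?s * ((cmod (v$1))\<^sup>2 + (cmod (v$3))\<^sup>2) - (cmod (n / m))\<^sup>2 * (cmod (v$2))\<^sup>2" for v
  proof -
    have "complex_of_real ((cmod (a * v$1 - cnj b * v$3))\<^sup>2 + (cmod (b * v$1 + cnj a * v$3))\<^sup>2) =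
       complex_of_real (((cmod a)\<^sup>2 + (cmod b)\<^sup>2) * ((cmod (v$1))\<^sup>2 + (cmod (v$3))\<^sup>2))"
      unfolding of_real_add of_real_mult complex_norm_square by (simp add: algebra_simps)
    then have "(cmod (a * v$1 - cnj b * v$3))\<^sup>2 + (cmod (b * v$1 + cnj a * v$3))\<^sup>2 =
       ?s * ((cmod (v$1))\<^sup>2 + (cmod (v$3))\<^sup>2)"
      by (simp only: of_real_eq_iff s)
    moreover have "(cmod (n / m * v$2))\<^sup>2 = (cmod (n / m))\<^sup>2 * (cmod (v$2))\<^sup>2"
      by (simp only: norm_mult power_mult_distrib)
    ultimately show ?thesis
      unfolding hform_self Re_complex_of_real mult vector_3 by linarith
  qed
  have "?s * Re (hform v v) \<le> Re (hform (shrink_mat m n *v v) (shrink_mat m n *v v))" for v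
    using mult_right_mono [OF \<open>(cmod (n / m))\<^sup>2 \<le> ?s\<close> zero_le_power2, of "cmod (v$2)"]
    unfolding form unfolding hform_self Re_complex_of_real ring_distribs by linarith
  moreover have "0 < ?s"
    by (intro divide_pos_pos add_pos_nonneg) auto
  moreover have "det (shrink_mat m n) = (a * cnj a + b * cnj b) * (n / m)"
    by (simp add: S det_3 vector_3 algebra_simps)
  then have "invertible (shrink_mat m n)"
    unfolding ab invertible_det_nz
    using \<open>0 < ?s\<close> \<open>m \<noteq> 0\<close> \<open>n \<noteq> 0\<close>
    by (metis mult_eq_0_iff divide_eq_0_iff of_real_eq_0_iff less_irrefl)
  ultimately show "expansive ?s (shrink_mat m n)"
    by (simp add: expansive_def)
  have "(a - cnj b * m\<^sup>2) * k = 1 * k" "(b + cnj a * m\<^sup>2) * k = n\<^sup>2 * k"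
    unfolding left_diff_distrib distrib_right mult.assoc [of _ "m\<^sup>2" k] mult.commute [of "m\<^sup>2" k]
      mult.assoc [symmetric] ak bk
    unfolding k_def by (simp_all add: algebra_simps)
  then have "a - cnj b * m\<^sup>2 = 1" "b + cnj a * m\<^sup>2 = n\<^sup>2"
    using \<open>k \<noteq> 0\<close> by simp_all
  then have "shrink_mat m n *v lift m = 1 *s lift n" "shrink_mat m n *v lift (- m) = 1 *s lift (- n)"
    unfolding mult using \<open>m \<noteq> 0\<close> by (simp_all add: aff_def Phi_def mult.commute)
  then show "carries (shrink_mat m n) (lift m) (lift n)" "carries (shrink_mat m n) (lift (- m)) (lift (- n))"
    unfolding carries_def by (metis zero_neq_one)+
qed

text \<open>Normalise the source pair, shrink \<open>m\<close> to \<open>n\<close>, then undo the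
  normalisation of the target pair. Distinctness of the targets gives \<open>n \<noteq> 0\<close>,
  as \<open>shrink_mat\<close> requires.\<close>

lemma expansive_interpolation:
  assumes D: "l\<^sub>1 \<in> unit_disk" "l\<^sub>2 \<in> unit_disk" "w\<^sub>1 \<in> unit_disk" "w\<^sub>2 \<in> unit_disk"
    and ne: "l\<^sub>1 \<noteq> l\<^sub>2" "w\<^sub>1 \<noteq> w\<^sub>2" and le: "gram_ratio w\<^sub>1 w\<^sub>2 \<le> gram_ratio l\<^sub>1 l\<^sub>2"
  obtains A s where "expansive s A" "carries A (lift l\<^sub>1) (lift w\<^sub>1)" "carries A (lift l\<^sub>2) (lift w\<^sub>2)"
proof -
  obtain m A s where m: "m \<in> unit_disk" "m \<noteq> 0"
    and mr: "1 - 1 / gram_ratio l\<^sub>1 l\<^sub>2 = (2 * cmod m / (1 + (cmod m)\<^sup>2))\<^sup>2"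
    and A: "expansive s A" "carries A (lift l\<^sub>1) (lift (- m))" "carries A (lift l\<^sub>2) (lift m)"
    using normalise_pair [OF D(1,2) ne(1)] by metis
  obtain n B t where n: "n \<in> unit_disk" "n \<noteq> 0"
    and nr: "1 - 1 / gram_ratio w\<^sub>1 w\<^sub>2 = (2 * cmod n / (1 + (cmod n)\<^sup>2))\<^sup>2"
    and B: "expansive t B" "carries B (lift (- n)) (lift w\<^sub>1)" "carries B (lift n) (lift w\<^sub>2)"
    using normalise_pair [OF D(3,4) ne(2)] by metis
  have "1 - 1 / gram_ratio w\<^sub>1 w\<^sub>2 \<le> 1 - 1 / gram_ratio l\<^sub>1 l\<^sub>2"
    using le gram_ratio_pos [OF D(1,2)] gram_ratio_pos [OF D(3,4)] by (simp add: frac_le)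
  then have "2 * cmod n / (1 + (cmod n)\<^sup>2) \<le> 2 * cmod m / (1 + (cmod m)\<^sup>2)"
    unfolding mr nr by (rule power2_le_imp_le) simp
  then have "cmod n * (1 + (cmod m)\<^sup>2) \<le> cmod m * (1 + (cmod n)\<^sup>2)"
    by (simp add: divide_simps add_pos_nonneg algebra_simps split: if_splits)
  \<comment> \<open>This factorisation shows that \<open>2 t / (1 + t\<^sup>2)\<close> is increasing
    on \<open>[0, 1)\<close>.\<close>
  then have "0 \<le> (cmod m - cmod n) * (1 - cmod m * cmod n)"
    by (simp add: algebra_simps power2_eq_square)
  moreover have "cmod m * cmod n < 1 * 1"
    using m n by (intro mult_strict_mono') auto
  ultimately have "cmod n \<le> cmod m"
    by (simp add: zero_le_mult_iff)
  then have "0 < cmod n" "cmod n \<le> cmod m" "cmod m < 1"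
    using m n by auto
  note shrink = shrink_mat [OF this]
  show ?thesis
    using that [of _ "B ** (shrink_mat m n ** A)"] expansive_mult [OF expansive_mult [OF A(1) shrink(1)] B(1)]
      carries_mult [OF carries_mult [OF A(2) shrink(3)] B(2)]
      carries_mult [OF carries_mult [OF A(3) shrink(2)] B(3)] by blast
qed

section \<open>Fractional linear maps\<close>

definition affine_poly2 :: "complex^3 \<Rightarrow> complex poly poly" where
  "affine_poly2 r = [:[:r$1, r$2:], [:r$3:]:]"

lemma poly2_affine_poly2: "poly2 (affine_poly2 r) z = r$1 + r$2 * fst z + r$3 * snd z"
  by (simp add: poly2_def affine_poly2_def algebra_simps)

lemma affine_poly2_lincomb:
  "affine_poly2 (a *s r + b *s r') =
    [:[:a:]:] * affine_poly2 r + [:[:b:]:] * affine_poly2 r'"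
  by (simp add: affine_poly2_def)

lemma affine_poly2_eq_0_iff: "affine_poly2 r = 0 \<longleftrightarrow> r = 0"
  by (simp add: affine_poly2_def vec_eq_iff forall_3)

text \<open>A common divisor divides a combination free of the outer variable, hence is constant in that
  variable; then it divides the outer coefficients separately.\<close>

lemma coprime_affine_poly2:
  assumes indep: "\<And>a b. a *s r + b *s r' = 0 \<Longrightarrow> a = 0 \<and> b = 0"
  shows "coprime (affine_poly2 r) (affine_poly2 r')"
proof (rule coprimeI)
  fix d assume d: "d dvd affine_poly2 r" "d dvd affine_poly2 r'"
  have comb: "d dvd affine_poly2 (a *s r + b *s r')" for a b
    using d unfolding affine_poly2_lincomb by (intro dvd_add dvd_mult)
  define e where "e = coeff d 0"
  have degree_0: "d = [:e:]" if "v \<noteq> 0" "v$3 = 0" "d dvd affine_poly2 v" for v :: "complex^3"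
  proof -
    have "degree d \<le> degree (affine_poly2 v)"
      using that by (intro dvd_imp_degree_le) (auto simp: affine_poly2_eq_0_iff)
    also have "\<dots> = 0"
      using \<open>v$3 = 0\<close> by (simp add: affine_poly2_def)
    finally show ?thesis
      unfolding e_def by (metis degree_eq_zeroE le_zero_eq coeff_pCons_0)
  qed
  have dvd_coeff: "e dvd [:v$3:]" "e dvd [:v$1, v$2:]" if "d = [:e:]" "d dvd affine_poly2 v" for v :: "complex^3"
    using that(2) unfolding that(1) affine_poly2_def const_poly_dvd_iff
    by (metis coeff_pCons_0 coeff_pCons_Suc)+
  have is_unit: "is_unit d" if "d = [:e:]" "e dvd [:c:]" "c \<noteq> 0" for c
  proof -
    have "is_unit [:c:]"
      using \<open>c \<noteq> 0\<close> by (simp add: is_unit_const_poly_iff dvd_field_iff)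
    then have "is_unit e"
      using that(2) dvd_trans by blast
    then show ?thesis
      unfolding that(1) by (simp add: is_unit_const_poly_iff)
  qed
  show "is_unit d"
  proof (cases "r$3 = 0 \<and> r'$3 = 0")
    case False
    define v where "v = r'$3 *s r + (- r$3) *s r'"
    have "v \<noteq> 0"
      using indep [of "r'$3" "- r$3"] False by (auto simp: v_def)
    moreover have "v$3 = 0"
      by (simp add: v_def)
    moreover have "d dvd affine_poly2 v"
      unfolding v_def by (rule comb)
    ultimately have "d = [:e:]"
      by (rule degree_0)
    then show ?thesis
      using is_unit dvd_coeff(1) d False by metis
  next
    case True
    have "r \<noteq> 0"
      using indep [of 1 0] by auto
    then have de: "d = [:e:]"
      using degree_0 d True by blast
    \<comment> \<open>Neither row involves the outer variable now, so the inner one is eliminated as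
      well; what remains is a constant, and if it is zero, both rows are constant.\<close>
    define v where "v = r'$2 *s r + (- r$2) *s r'"
    have "v$2 = 0" "v$3 = 0"
      using True by (auto simp: v_def)
    show ?thesis
    proof (cases "v$1 = 0")
      case False
      have "e dvd [:v$1, v$2:]"
        using dvd_coeff(2) [OF de] comb unfolding v_def by blast
      then show ?thesis
        using is_unit [OF de] False \<open>v$2 = 0\<close> by simp
    next
      case v0: True
      then have "v = 0"
        using \<open>v$2 = 0\<close> \<open>v$3 = 0\<close> by (simp add: vec_eq_iff forall_3)
      then have r2: "r$2 = 0" "r'$2 = 0"
        using indep [of "r'$2" "- r$2"] by (simp_all add: v_def)
      then have "r$1 \<noteq> 0"
        using \<open>r \<noteq> 0\<close> True by (auto simp: vec_eq_iff forall_3)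
      then show ?thesis
        using is_unit [OF de] dvd_coeff(2) [OF de d(1)] r2 by simp
    qed
  qed
qed

text \<open>Multiplication by a right inverse turns the rows into distinct unit vectors. This is
  what makes the fractions of \<open>frac_linear\<close> reduced.\<close>

lemma invertible_rows_independent:
  fixes A :: "complex^'n^'n"
  assumes "invertible A" "i \<noteq> j" and zero: "a *s A$i + b *s A$j = 0"
  shows "a = 0 \<and> b = 0"
proof -
  obtain B where B: "A ** B = mat 1"
    using assms(1) by (auto simp: invertible_def)
  have row: "a * (A ** B)$i$k + b * (A ** B)$j$k = 0" for k
  proof -
    have "a * (A ** B)$i$k + b * (A ** B)$j$k = (\<Sum>l\<in>UNIV. (a *s A$i + b *s A$j)$l * B$l$k)"
      by (simp add: matrix_matrix_mult_def sum_distrib_left sum.distrib algebra_simps)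
    then show ?thesis
      by (simp add: zero)
  qed
  show ?thesis
    using row [of i] row [of j] \<open>i \<noteq> j\<close> by (simp add: B mat_def)
qed

definition frac_linear :: "complex^3^3 \<Rightarrow> complex \<times> complex \<rightharpoonup> complex \<times> complex" where
  "frac_linear A = rational_map (affine_poly2 (A$2)) (affine_poly2 (A$1))
     (affine_poly2 (A$3)) (affine_poly2 (A$1))"

lemma poly2_affine_row: "poly2 (affine_poly2 (A$i)) z = (A *v aff z)$i"
  by (simp add: poly2_affine_poly2 matrix_vector_mult_def sum_3 aff_def vector_3)

lemma frac_linear_eq_Some_iff:
  "frac_linear A z = Some w \<longleftrightarrow> (A *v aff z)$1 \<noteq> 0 \<and> A *v aff z = (A *v aff z)$1 *s aff w"
  by (cases w) (auto simp: frac_linear_def rational_map_def poly2_affine_row vec_eq_iff forall_3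
      aff_def vector_3 nonzero_divide_eq_eq mult.commute)

lemma frac_linear_of_carries:
  assumes "carries A (aff z) (aff w)"
  shows "frac_linear A z = Some w"
proof -
  obtain a where a: "a \<noteq> 0" "A *v aff z = a *s aff w"
    using assms by (auto simp: carries_def)
  then have "(A *v aff z)$1 = a"
    by (simp add: aff_def vector_3)
  then show ?thesis
    using a by (simp add: frac_linear_eq_Some_iff)
qed

text \<open>A point is in \<open>Omega\<close> exactly when \<open>hform\<close> is positive on its
  lift by \<open>aff\<close>; expansion preserves this, and the projective factor only contributes
  \<open>|q|\<^sup>2\<close>.\<close>

lemma frac_linear_in_R_Omega:
  assumes "expansive s A"
  shows "frac_linear A \<in> R_Omega"
proof -
  have inv: "invertible A"
    using assms by (simp add: expansive_def)
  have "A$1 \<noteq> 0"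
    using invertible_rows_independent [OF inv, of 1 2 1 0] by auto
  moreover have "coprime (affine_poly2 (A$2)) (affine_poly2 (A$1))" "coprime (affine_poly2 (A$3)) (affine_poly2 (A$1))"
    using invertible_rows_independent [OF inv, of 2 1] invertible_rows_independent [OF inv, of 3 1]
    by (auto intro!: coprime_affine_poly2)
  ultimately have "frac_linear A \<in> rational_maps"
    unfolding rational_maps_def frac_linear_def using affine_poly2_eq_0_iff by blast
  moreover have "w \<in> Omega" if z: "z \<in> Omega" and w: "frac_linear A z = Some w" for z w
  proof -
    define q where "q = (A *v aff z)$1"
    have q: "A *v aff z = q *s aff w"
      using w by (simp add: frac_linear_eq_Some_iff q_def)
    have "0 < s * Re (hform (aff z) (aff z))"
      using z assms by (simp add: Omega_def hform_aff expansive_def)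
    also have "\<dots> \<le> Re (hform (A *v aff z) (A *v aff z))"
      using assms by (simp add: expansive_def)
    also have "hform (A *v aff z) (A *v aff z) = complex_of_real ((cmod q)\<^sup>2) * hform (aff w) (aff w)"
      by (simp only: q hform_smult complex_norm_square)
    finally have "0 < (cmod q)\<^sup>2 * Re (hform (aff w) (aff w))"
      by simp
    then show ?thesis
      by (simp add: zero_less_mult_iff Omega_def hform_aff)
  qed
  ultimately show ?thesis
    by (auto simp: R_Omega_def)
qed

section \<open>Positivity of the kernels of fractional linear and constant maps\<close>

lemma hform_sum:
  fixes n :: nat
  shows
  "hform (\<Sum>i<n. cnj (c i) *s g i) (\<Sum>i<n. cnj (c i) *s g i) =
    (\<Sum>i<n. \<Sum>j<n. hform (g i) (g j) * c j * cnj (c i))"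
proof -
  have *: "(\<Sum>i<n. cnj (c i) * f i) * cnj (\<Sum>i<n. cnj (c i) * f i) =
      (\<Sum>i<n. \<Sum>j<n. f i * cnj (f j) * c j * cnj (c i))" for f :: "nat \<Rightarrow> complex"
    unfolding cnj_sum sum_product by (simp add: mult_ac)
  show ?thesis
    unfolding hform_def sum_component vector_smult_component *
    by (simp add: algebra_simps sum.distrib sum_subtractf)
qed

text \<open>By sesquilinearity the quadratic form is the defect of \<open>A\<close> at one combined
  vector, where expansiveness applies. Its coefficients are conjugated because the row index carries
  \<open>cnj (c i)\<close>.\<close>

lemma psd_kernel_on_expansive_defect:
  assumes "expansive s A"
  shows "psd_kernel_on S (\<lambda>x y. hform (A *v g x) (A *v g y) - complex_of_real s * hform (g x) (g y))"
  unfolding psd_kernel_on_iff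
proof (intro allI impI)
  fix n :: nat and x and c :: "nat \<Rightarrow> complex"
  define v where "v = (\<Sum>i<n. cnj (c i) *s g (x i))"
  have "A *v v = (\<Sum>i<n. cnj (c i) *s (A *v g (x i)))"
    unfolding v_def by (induction n) (simp_all add: matrix_vector_right_distrib vector_scalar_commute)
  then have "(\<Sum>i<n. \<Sum>j<n. (hform (A *v g (x i)) (A *v g (x j)) - complex_of_real s * hform (g (x i)) (g (x j))) * c j * cnj (c i))
      = hform (A *v v) (A *v v) - complex_of_real s * hform v v"
    by (simp only: v_def hform_sum left_diff_distrib sum_subtractf mult.assoc sum_distrib_left)
  also have "\<dots> \<in> \<real>\<^sub>\<ge>\<^sub>0"
    using assms by (simp add: complex_nonneg_Reals_iff expansive_def hform_self)
  finally show "(\<Sum>i<n. \<Sum>j<n. (hform (A *v g (x i)) (A *v g (x j)) - complex_of_real s * hform (g (x i)) (g (x j))) * c j * cnj (c i)) \<in> \<real>\<^sub>\<ge>\<^sub>0" .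
qed

text \<open>Subtracting and adding \<open>s\<close> times the form splits the numerator: the defect
  \<open>G\<close> is positive and stays so after multiplication by the Bergman kernel, while the
  added term divided by the denominator is the constant \<open>s\<close>.\<close>

lemma frac_linear_in_RS_Phi_Omega:
  assumes "expansive s A"
  shows "frac_linear A \<in> RS_Phi_Omega"
proof -
  define S where "S = {z \<in> unit_disk. Phi z \<in> dom (frac_linear A)}"
  define q where "q z = (A *v lift z)$1" for z
  define G where "G z l = hform (A *v lift z) (A *v lift l) - complex_of_real s * hform (lift z) (lift l)" for z l
  define F where "F z = the (frac_linear A (Phi z))" for z
  have "S \<subseteq> unit_disk"
    by (auto simp: S_def)
  have "psd_kernel_on S G"
    unfolding G_def using assms by (rule psd_kernel_on_expansive_defect)
  then have "psd_kernel_on S (\<lambda>z l. (1 / q z) * cnj (1 / q l) *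
      (G z l / (1 - z * cnj l)\<^sup>2 + complex_of_real s * 1))"
    using assms \<open>S \<subseteq> unit_disk\<close>
    by (intro psd_kernel_on_weighted psd_kernel_on_add psd_kernel_on_divide_bergman
        psd_kernel_on_cmult psd_kernel_on_one) (auto simp: expansive_def)
  then have "psd_kernel_on S (\<lambda>z l. (1 - inner_K (F z) (F l)) / (1 - inner_K (Phi z) (Phi l)))"
  proof (rule psd_kernel_on_cong)
    fix z l assume zl: "z \<in> S" "l \<in> S"
    have q: "q z \<noteq> 0" "A *v lift z = q z *s aff (F z)" if "z \<in> S" for z
    proof -
      have "frac_linear A (Phi z) = Some (F z)"
        using that by (auto simp: S_def F_def)
      then show "q z \<noteq> 0" "A *v lift z = q z *s aff (F z)"
        by (auto simp: frac_linear_eq_Some_iff q_def)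
    qed
    have nz: "(1 - z * cnj l)\<^sup>2 \<noteq> 0"
      using one_minus_mult_cnj_ne_0 [of z l] zl by (simp add: S_def)
    have "G z l = q z * cnj (q l) * (1 - inner_K (F z) (F l)) - complex_of_real s * (1 - z * cnj l)\<^sup>2"
      unfolding G_def q(2) [OF zl(1)] q(2) [OF zl(2)] hform_smult hform_aff one_minus_inner_K_Phi ..
    then have "G z l / (1 - z * cnj l)\<^sup>2 + complex_of_real s * 1 =
        q z * cnj (q l) * (1 - inner_K (F z) (F l)) / (1 - z * cnj l)\<^sup>2"
      using nz by (simp add: diff_divide_distrib)
    then show "(1 / q z) * cnj (1 / q l) * (G z l / (1 - z * cnj l)\<^sup>2 + complex_of_real s * 1) =
        (1 - inner_K (F z) (F l)) / (1 - inner_K (Phi z) (Phi l))"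
      using q(1) zl by (simp add: one_minus_inner_K_Phi)
  qed
  then show ?thesis
    using frac_linear_in_R_Omega [OF assms] by (simp add: RS_Phi_Omega_def S_def F_def)
qed

text \<open>Serves coinciding targets. The kernel is a positive multiple of the Bergman
  kernel.\<close>

lemma const_in_RS_Phi_Omega:
  assumes "w \<in> unit_disk"
  shows "(\<lambda>z. Some (Phi w)) \<in> RS_Phi_Omega"
proof -
  define c where "c = 1 - (cmod w)\<^sup>2"
  have c: "1 - w * cnj w = complex_of_real c"
    by (simp only: c_def of_real_diff of_real_1 complex_norm_square)
  have K: "1 - inner_K (Phi w) (Phi w) = complex_of_real (c\<^sup>2)"
    by (simp only: one_minus_inner_K_Phi c of_real_power)
  have "0 < c"
    using one_minus_cmod_sq_pos [OF assms] by (simp add: c_def)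
  have "Re (1 - inner_K (Phi w) (Phi w)) > 0"
    unfolding K Re_complex_of_real using \<open>0 < c\<close> by simp
  then have "Phi w \<in> Omega"
    by (simp add: Omega_def)
  moreover have "(\<lambda>z. Some (Phi w)) = rational_map [:[:fst (Phi w):]:] 1 [:[:snd (Phi w):]:] 1"
    by (auto simp: rational_map_def poly2_def)
  then have "(\<lambda>z. Some (Phi w)) \<in> rational_maps"
    unfolding rational_maps_def by fastforce
  ultimately have "(\<lambda>z. Some (Phi w)) \<in> R_Omega"
    by (simp add: R_Omega_def)
  moreover have "psd_kernel_on unit_disk (\<lambda>z l. complex_of_real (c\<^sup>2) * 1 / (1 - z * cnj l)\<^sup>2)"
    by (intro psd_kernel_on_divide_bergman psd_kernel_on_cmult psd_kernel_on_one) auto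
  moreover have dom: "{z \<in> unit_disk. Phi z \<in> dom (\<lambda>z. Some (Phi w))} = unit_disk"
    by auto
  ultimately show ?thesis
    unfolding RS_Phi_Omega_def mem_Collect_eq dom option.sel one_minus_inner_K_Phi c
    by simp
qed

theorem theorem5p3:
  fixes l\<^sub>1 l\<^sub>2 w\<^sub>1 w\<^sub>2 :: complex
  assumes "l\<^sub>1 \<in> unit_disk" and "l\<^sub>2 \<in> unit_disk" and "l\<^sub>1 \<noteq> l\<^sub>2"
    and "w\<^sub>1 \<in> unit_disk" and "w\<^sub>2 \<in> unit_disk"
  shows "(psd_matrix 2 (M_Phi [l\<^sub>1, l\<^sub>2] [w\<^sub>1, w\<^sub>2])
            \<longleftrightarrow> psd_matrix 2 (pick_matrix [l\<^sub>1, l\<^sub>2] [w\<^sub>1, w\<^sub>2])) \<and>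
         (psd_matrix 2 (pick_matrix [l\<^sub>1, l\<^sub>2] [w\<^sub>1, w\<^sub>2])
            \<longleftrightarrow> bergman_dist w\<^sub>1 w\<^sub>2 \<le> bergman_dist l\<^sub>1 l\<^sub>2) \<and>
         (bergman_dist w\<^sub>1 w\<^sub>2 \<le> bergman_dist l\<^sub>1 l\<^sub>2
            \<longleftrightarrow> (\<exists>F \<in> RS_Phi_Omega. F (Phi l\<^sub>1) = Some (Phi w\<^sub>1) \<and> F (Phi l\<^sub>2) = Some (Phi w\<^sub>2)))"
proof -
  let ?N = "gram_ratio w\<^sub>1 w\<^sub>2 \<le> gram_ratio l\<^sub>1 l\<^sub>2"
  have M_Phi: "M_Phi [l\<^sub>1, l\<^sub>2] [w\<^sub>1, w\<^sub>2] = (\<lambda>i j. pick_matrix [l\<^sub>1, l\<^sub>2] [w\<^sub>1, w\<^sub>2] i j ^ 2)"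
    by (simp add: fun_eq_iff M_Phi_def pick_matrix_def one_minus_inner_K_Phi power_divide)
  have "psd_matrix 2 (M_Phi [l\<^sub>1, l\<^sub>2] [w\<^sub>1, w\<^sub>2]) \<longleftrightarrow> ?N"
    unfolding M_Phi using assms by (intro psd_pick_power_iff) auto
  moreover have "psd_matrix 2 (pick_matrix [l\<^sub>1, l\<^sub>2] [w\<^sub>1, w\<^sub>2]) \<longleftrightarrow> ?N"
    using psd_pick_power_iff [OF assms(1,2,4,5), of 1] by simp
  moreover have "bergman_dist w\<^sub>1 w\<^sub>2 \<le> bergman_dist l\<^sub>1 l\<^sub>2 \<longleftrightarrow> ?N"
    using assms by (intro bergman_dist_le_iff)
  moreover have "\<exists>F \<in> RS_Phi_Omega. F (Phi l\<^sub>1) = Some (Phi w\<^sub>1) \<and> F (Phi l\<^sub>2) = Some (Phi w\<^sub>2)" if N: ?N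
  \<comment> \<open>Lifts of distinct points are linearly independent, so no invertible matrix
    carries them to the same point; equal targets need the constant map.\<close>
  proof (cases "w\<^sub>1 = w\<^sub>2")
    case True
    then show ?thesis
      using const_in_RS_Phi_Omega [OF assms(4)] by (intro bexI) auto
  next
    case False
    obtain A s where "expansive s A" "carries A (lift l\<^sub>1) (lift w\<^sub>1)" "carries A (lift l\<^sub>2) (lift w\<^sub>2)"
      by (rule expansive_interpolation [OF assms(1,2,4,5,3) False N])
    then show ?thesis
      using frac_linear_in_RS_Phi_Omega frac_linear_of_carries by blast
  qed
  moreover have "psd_matrix 2 (M_Phi [l\<^sub>1, l\<^sub>2] [w\<^sub>1, w\<^sub>2])"
    if F: "F \<in> RS_Phi_Omega" "F (Phi l\<^sub>1) = Some (Phi w\<^sub>1)" "F (Phi l\<^sub>2) = Some (Phi w\<^sub>2)" for F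
  proof -
    let ?K = "\<lambda>z l. (1 - inner_K (the (F (Phi z))) (the (F (Phi l)))) / (1 - inner_K (Phi z) (Phi l))"
    have K: "psd_kernel_on {z \<in> unit_disk. Phi z \<in> dom F} ?K"
      using F(1) by (simp add: RS_Phi_Omega_def)
    \<comment> \<open>Restricted to the two nodes, the kernel of \<open>F\<close> is
      \<open>M_Phi\<close>, which closes the circle of implications.\<close>
    have "set [l\<^sub>1, l\<^sub>2] \<subseteq> {z \<in> unit_disk. Phi z \<in> dom F}"
      using F assms by auto
    then have "psd_matrix (length [l\<^sub>1, l\<^sub>2]) (\<lambda>i j. ?K ([l\<^sub>1, l\<^sub>2] ! i) ([l\<^sub>1, l\<^sub>2] ! j))"
      using K unfolding psd_kernel_on_def by blast
    then show ?thesis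
      using F(2,3) by (simp add: psd_matrix_def M_Phi_def numeral_2_eq_2 lessThan_Suc)
  qed
  ultimately show ?thesis
    by blast
qed

end
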